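(* Let $G$ be a connected, locally finite, $k$-regular graph and let $Q=Q_G$ be its quotient graph by the twin relation, with its path metric. Let $F\colon\mathcal{K}(G)\to\mathcal{K}(G)$ be a nonexpansive bijection. Then there is a bijective isometry $q\colon Q\to Q$ such that $$F^{-1}[\mathcal{K}(C)]=\mathcal{K}(q(C))\quad\text{and}\quad |q(C)|=|C|$$ for every twin class $C\in Q$.
   Context: Graphs are simple, undirected and unweighted. A connected graph is identified with its vertex set and equipped with the path metric (minimal length of a walk). A graph is locally finite if every vertex has finite degree, and $k$-regular if every vertex has degree $k$. $\overline{B}(v,1)$ denotes the closed unit ball at $v$. Twin classes of $G$ are the equivalence classes of $u\equiv v\iff\overline{B}(u,1)=\overline{B}(v,1)$; they are finite when $G$ is locally finite. The quotient graph $Q_G$ has the twin classes as vertices, two distinct classes $C,D$ being adjacent if some vertex of $C$ is adjacent in $G$ to some vertex of $D$; it is a simple connected locally finite graph. $\mathcal{K}(G)$ is the set of nonempty compact (equivalently, nonempty finite) subsets of $G$ with the Hausdorff metric, and for $C\subseteq G$, $\mathcal{K}(C)\subseteq\mathcal{K}(G)$ is the family of nonempty finite subsets of $C$. A map $f$ is nonexpansive if $d(f(x),f(y))\le d(x,y)$ for all $x,y$. *)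

theory Defs
  imports "HOL-Analysis.Analysis" "Graph_Theory.Pair_Digraph" "Graph_Theory.Digraph_Component"
begin

text \<open>
  A simple undirected graph, possibly infinite, is a loop-free symmetric digraph without parallel
  arcs, that is, a \<^locale>\<open>pair_bidirected_digraph\<close>: an edge between u and v is represented
  by the two arcs (u,v) and (v,u), so the degree of a vertex is its \<^const>\<open>out_degree\<close>.
\<close>

definition locally_finite :: "'a pair_pre_digraph \<Rightarrow> bool" where
  "locally_finite G \<longleftrightarrow> (\<forall>v\<in>pverts G. finite (out_arcs (with_proj G) v))"

text \<open>
  For infinite arc sets \<^const>\<open>out_degree\<close> is 0 by convention, so this is only
  meaningful for locally finite graphs.
\<close>
definition regular :: "nat \<Rightarrow> 'a pair_pre_digraph \<Rightarrow> bool" where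
  "regular k G \<longleftrightarrow> (\<forall>v\<in>pverts G. out_degree (with_proj G) v = k)"

text \<open>Unspecified if no walk joins u to v; only used for connected graphs.\<close>
definition path_dist :: "'a pair_pre_digraph \<Rightarrow> 'a \<Rightarrow> 'a \<Rightarrow> real" where
  "path_dist G u v =
    real (LEAST n. \<exists>p. pre_digraph.awalk (with_proj G) u p v \<and> length p = n)"

definition hausdorff_dist :: "('a \<Rightarrow> 'a \<Rightarrow> real) \<Rightarrow> 'a set \<Rightarrow> 'a set \<Rightarrow> real" where
  "hausdorff_dist d A B =
    max (SUP a\<in>A. INF b\<in>B. d a b) (SUP b\<in>B. INF a\<in>A. d a b)"

text \<open>
  The nonempty compact subsets of the metric space G that are contained in C; the whole hyperspace
  is the case \<open>C = pverts G\<close>. Compact is the same as finite here, see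
  \<open>hyperspace_eq_finite\<close> below.
\<close>
definition hyperspace :: "'a pair_pre_digraph \<Rightarrow> 'a set \<Rightarrow> 'a set set" where
  "hyperspace G C =
    {A. A \<subseteq> C \<and> A \<noteq> {} \<and>
        compactin (Metric_space.mtopology (pverts G) (path_dist G)) A}"

definition twin_rel :: "'a pair_pre_digraph \<Rightarrow> 'a rel" where
  "twin_rel G =
    {(u, v). u \<in> pverts G \<and> v \<in> pverts G \<and>
       Metric_space.mcball (pverts G) (path_dist G) u 1 =
       Metric_space.mcball (pverts G) (path_dist G) v 1}"

definition twin_quotient :: "'a pair_pre_digraph \<Rightarrow> 'a set pair_pre_digraph" where
  "twin_quotient G =
    \<lparr> pverts = pverts G // twin_rel G,
      parcs = {(C, D). C \<in> pverts G // twin_rel G \<and> D \<in> pverts G // twin_rel G \<and> C \<noteq> D \<and>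
                       (\<exists>u\<in>C. \<exists>v\<in>D. (u, v) \<in> parcs G)} \<rparr>"

context pair_bidirected_digraph
begin

lemma ex_awalk:
  assumes "Digraph_Component.connected (with_proj G)" "u \<in> pverts G" "v \<in> pverts G"
  shows "\<exists>p. awalk u p v"
proof -
  have "mk_symmetric (with_proj G) = G"
    using pair_sym_arcs by (auto simp: mk_symmetric_def symmetric_def sym_def intro!: pair_pre_digraph.equality)
  then have "u \<rightarrow>\<^sup>*\<^bsub>with_proj G\<^esub> v"
    using assms by (auto simp: Digraph_Component.connected_def strongly_connected_def)
  then show ?thesis by (simp add: reachable_awalk)
qed

lemma path_dist_le: "awalk u p v \<Longrightarrow> path_dist G u v \<le> length p"
  unfolding path_dist_def by (auto intro!: Least_le)

lemma path_dist_witness: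
  assumes "awalk u q v"
  obtains p where "awalk u p v" "path_dist G u v = length p"
proof -
  have "\<exists>n p. awalk u p v \<and> length p = n" using assms by blast
  then have "\<exists>p. awalk u p v \<and> length p = (LEAST n. \<exists>p. awalk u p v \<and> length p = n)"
    by (rule LeastI_ex)
  then obtain p where "awalk u p v" "length p = (LEAST n. \<exists>p. awalk u p v \<and> length p = n)"
    by blast
  then show thesis using that[of p] by (simp add: path_dist_def)
qed

lemma awalk_rev: "awalk u p v \<Longrightarrow> \<exists>q. awalk v q u \<and> length q = length p"
proof (induction p arbitrary: u)
  case Nil
  then show ?case by (auto simp: awalk_Nil_iff)
next
  case (Cons e p)
  then have e: "e \<in> parcs G" "fst e = u" and "awalk (snd e) p v" by (auto simp: awalk_Cons_iff)
  then obtain q where q: "awalk v q (snd e)" "length q = length p" using Cons.IH by blast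
  have "(snd e, fst e) \<in> parcs G"
    using e pair_sym_arcs by (auto simp: symmetric_def sym_def)
  then have "awalk (snd e) [(snd e, u)] u"
    using e arc_fst_in_verts arc_snd_in_verts by (auto simp: awalk_def)
  then have "awalk v (q @ [(snd e, u)]) u" using q(1) by (rule awalk_appendI[rotated])
  then show ?case using q(2) by (metis length_append_singleton length_Cons)
qed

lemma Metric_space_path_dist:
  assumes con: "Digraph_Component.connected (with_proj G)"
  shows "Metric_space (pverts G) (path_dist G)"
proof
  show "0 \<le> path_dist G x y" for x y by (simp add: path_dist_def)
  have le: "path_dist G x y \<le> path_dist G y x" for x y
  proof (cases "\<exists>p. awalk x p y \<or> awalk y p x")
    case True
    then obtain r where "awalk y r x" using awalk_rev by blast
    then obtain p where "awalk y p x" "path_dist G y x = length p" by (rule path_dist_witness)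
    then show ?thesis using awalk_rev path_dist_le by metis
  next
    case False
    then show ?thesis unfolding path_dist_def by simp
  qed
  show "path_dist G x y = path_dist G y x" for x y using le[of x y] le[of y x] by simp
  fix x y z assume x: "x \<in> pverts G" and y: "y \<in> pverts G"
  show "path_dist G x y = 0 \<longleftrightarrow> x = y"
  proof
    assume 0: "path_dist G x y = 0"
    obtain r where "awalk x r y" using ex_awalk[OF con x y] ..
    then obtain p where "awalk x p y" "path_dist G x y = length p" by (rule path_dist_witness)
    then show "x = y" using 0 by (auto simp: awalk_Nil_iff)
  next
    assume "x = y"
    then show "path_dist G x y = 0" using path_dist_le[of x "[]" y] x
      by (auto simp: awalk_Nil_iff path_dist_def)
  qed
  assume z: "z \<in> pverts G"
  obtain r s where "awalk x r y" "awalk y s z" using ex_awalk[OF con] x y z by blast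
  then obtain p q where "awalk x p y" "path_dist G x y = length p"
     and "awalk y q z" "path_dist G y z = length q" by (metis path_dist_witness)
  then show "path_dist G x z \<le> path_dist G x y + path_dist G y z"
    using path_dist_le[of x "p @ q" z] by (auto intro: awalk_appendI)
qed

lemma hyperspace_eq_finite:
  assumes con: "Digraph_Component.connected (with_proj G)" and "C \<subseteq> pverts G"
  shows "hyperspace G C = {A. A \<subseteq> C \<and> A \<noteq> {} \<and> finite A}"
proof -
  interpret M: Metric_space "pverts G" "path_dist G" by (rule Metric_space_path_dist[OF con])
  have sing: "openin M.mtopology {v}" if v: "v \<in> pverts G" for v
  proof -
    have "M.mball v 1 \<subseteq> {v}"
    proof
      fix w assume "w \<in> M.mball v 1"
      then have "w \<in> pverts G" "path_dist G v w < 1" by auto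
      then have "path_dist G v w = 0" by (simp add: path_dist_def)
      then show "w \<in> {v}" using M.zero v \<open>w \<in> pverts G\<close> by auto
    qed
    then have "M.mball v 1 = {v}" using v by auto
    then show ?thesis using M.openin_mball by metis
  qed
  then have "M.mtopology = discrete_topology (pverts G)"
    by (metis M.topspace_mtopology discrete_topology_unique)
  then have "compactin M.mtopology A \<longleftrightarrow> A \<subseteq> pverts G \<and> finite A" for A
    by (simp add: compactin_discrete_topology)
  then show ?thesis using assms(2) by (auto simp: hyperspace_def)
qed

lemma equiv_twin_rel: "equiv (pverts G) (twin_rel G)"
  by (rule equivI) (auto simp: refl_on_def sym_def trans_def twin_rel_def)

lemma pair_bidirected_digraph_twin_quotient: "pair_bidirected_digraph (twin_quotient G)"
proof
  show "symmetric (with_proj (twin_quotient G))"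
    using pair_sym_arcs by (fastforce simp: symmetric_def sym_def twin_quotient_def)
qed (auto simp: twin_quotient_def)

lemma connected_twin_quotient:
  assumes con: "Digraph_Component.connected (with_proj G)"
  shows "Digraph_Component.connected (with_proj (twin_quotient G))"
proof -
  let ?Q = "twin_quotient G" and ?c = "\<lambda>u. twin_rel G `` {u}"
  interpret Q: pair_bidirected_digraph ?Q by (rule pair_bidirected_digraph_twin_quotient)
  have cl: "?c u \<in> pverts ?Q" if "u \<in> pverts G" for u
    using that by (auto simp: twin_quotient_def intro: quotientI)
  have self: "u \<in> ?c u" if "u \<in> pverts G" for u
    using that by (auto simp: twin_rel_def)
  have walk: "\<exists>q. Q.awalk (?c u) q (?c v)" if "awalk u p v" for u p v
    using that
  proof (induction p arbitrary: u)
    case Nil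
    then have "Q.awalk (?c u) [] (?c v)" using cl by (auto simp: awalk_Nil_iff Q.awalk_Nil_iff)
    then show ?case ..
  next
    case (Cons e p)
    then have e: "e \<in> parcs G" "fst e = u" and "awalk (snd e) p v" by (auto simp: awalk_Cons_iff)
    then obtain q where q: "Q.awalk (?c (snd e)) q (?c v)" using Cons.IH by blast
    have uv: "u \<in> pverts G" "snd e \<in> pverts G" using e arc_fst_in_verts arc_snd_in_verts by auto
    show ?case
    proof (cases "?c u = ?c (snd e)")
      case True
      then show ?thesis using q by auto
    next
      case False
      have "(u, snd e) \<in> parcs G" using e by auto
      then have "(?c u, ?c (snd e)) \<in> parcs ?Q"
        using False cl[OF uv(1)] cl[OF uv(2)] self[OF uv(1)] self[OF uv(2)]
        by (auto simp: twin_quotient_def)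
      then have "Q.awalk (?c u) ((?c u, ?c (snd e)) # q) (?c v)"
        using q by (simp add: Q.awalk_Cons_iff)
      then show ?thesis ..
    qed
  qed
  have sym: "mk_symmetric (with_proj ?Q) = ?Q"
    using Q.pair_sym_arcs
    by (auto simp: mk_symmetric_def symmetric_def sym_def intro!: pair_pre_digraph.equality)
  have "pverts G \<noteq> {}"
    using con by (auto simp: Digraph_Component.connected_def strongly_connected_def mk_symmetric_def)
  then have ne: "pverts ?Q \<noteq> {}" using cl by blast
  have "C \<rightarrow>\<^sup>*\<^bsub>with_proj ?Q\<^esub> D" if C: "C \<in> pverts ?Q" and D: "D \<in> pverts ?Q" for C D
  proof -
    obtain u v where "u \<in> pverts G" "v \<in> pverts G" "C = ?c u" "D = ?c v"
      using C D by (auto simp: twin_quotient_def elim!: quotientE)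
    then show ?thesis using walk ex_awalk[OF con] by (metis Q.reachable_awalk)
  qed
  then show ?thesis using ne sym
    by (auto simp: Digraph_Component.connected_def strongly_connected_def)
qed

lemma finite_twin_class:
  assumes con: "Digraph_Component.connected (with_proj G)" and lf: "locally_finite G"
    and C: "C \<in> pverts (twin_quotient G)"
  shows "finite C"
proof -
  interpret M: Metric_space "pverts G" "path_dist G" by (rule Metric_space_path_dist[OF con])
  obtain u where u: "u \<in> pverts G" "C = twin_rel G `` {u}"
    using C by (auto simp: twin_quotient_def elim!: quotientE)
  have "C \<subseteq> insert u (snd ` out_arcs (with_proj G) u)"
  proof
    fix v assume "v \<in> C"
    then have v: "v \<in> pverts G" "M.mcball u 1 = M.mcball v 1" using u by (auto simp: twin_rel_def)
    then have "v \<in> M.mcball u 1" by simp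
    then have le: "path_dist G u v \<le> 1" by simp
    obtain r where "awalk u r v" using ex_awalk[OF con u(1) v(1)] ..
    then obtain p where p: "awalk u p v" "path_dist G u v = length p" by (rule path_dist_witness)
    then have "length p \<le> 1" using le by simp
    then consider "p = []" | e where "p = [e]" by (cases p) auto
    then show "v \<in> insert u (snd ` out_arcs (with_proj G) u)"
      using p(1) by cases (auto simp: awalk_Nil_iff awalk_Cons_iff out_arcs_def)
  qed
  then show ?thesis using lf u(1) by (auto simp: locally_finite_def intro: finite_subset)
qed

end

end

theory Submission
  imports Defs
begin

text \<open>
  The proof counts unit balls twice: once in the hyperspace, where it finds the sets of mutual
  twins, and once in the quotient, where it forces the class sizes to agree.

  Being nonexpansive and injective, \<open>F\<close> embeds the closed unit ball around \<open>A\<close> into the closed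
  unit ball around \<open>F A\<close>, so the latter is at least as large. If \<open>A\<close> lies in a single twin
  class, that ball consists of the nonempty subsets of one closed neighbourhood, so it has
  \<open>2 ^ (k + 1) - 1\<close> elements; in every other case it is strictly larger
  (\<open>card_unit_ball_non_twins\<close>). Hence, if \<open>F A\<close> is a set of twins, then so is \<open>A\<close>, the two balls
  have the same size, and \<open>F\<close> maps one onto the other (\<open>preimage_of_twins\<close>).

  For sets of twins the ball determines the twin class, and two of them are at distance at most 1
  exactly if their classes are equal or adjacent. So the inverse of \<open>F\<close> sends the subsets of a
  class \<open>C\<close> to subsets of one class \<open>q C\<close>, and \<open>q\<close> is injective and preserves and reflects
  adjacency. Comparing numbers of subsets gives \<open>|C| \<le> |q C|\<close>.

  It remains to exclude a strict inequality and to show that \<open>q\<close> is onto. By regularity the sizes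
  of the classes in a closed neighbourhood of the quotient add up to \<open>k + 1\<close>, whatever the centre.
  As \<open>q\<close> embeds the neighbourhood of \<open>C\<close> into that of \<open>q C\<close> without decreasing sizes, it
  is onto there and preserves all sizes (\<open>class_map_local_bijection\<close>). The image of \<open>q\<close> is
  therefore closed under adjacency, and it is everything because the quotient is connected. Equal
  sizes finally turn the inclusion of the preimage of the subsets of \<open>C\<close> in the subsets of \<open>q C\<close>
  into an equality.
\<close>

section \<open>Walks, connectedness and graph isomorphisms\<close>

context pair_bidirected_digraph
begin

lemma awalk_stays_in_closed_set:
  assumes "awalk u p v" "u \<in> S" "\<And>x y. x \<in> S \<Longrightarrow> (x, y) \<in> parcs G \<Longrightarrow> y \<in> S"
  shows "v \<in> S"
  using assms(1,2)
proof (induction p arbitrary: u)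
  case Nil
  then show ?case by (auto simp: awalk_Nil_iff)
next
  case (Cons e p)
  then have "e \<in> parcs G" "fst e = u" "awalk (snd e) p v" by (auto simp: awalk_Cons_iff)
  then show ?case using Cons.IH Cons.prems(2) assms(3) by (metis prod.collapse)
qed

lemma closed_set_eq_pverts:
  assumes "Digraph_Component.connected (with_proj G)" "S \<subseteq> pverts G" "S \<noteq> {}"
    and "\<And>x y. x \<in> S \<Longrightarrow> (x, y) \<in> parcs G \<Longrightarrow> y \<in> S"
  shows "S = pverts G"
proof -
  obtain u where u: "u \<in> S" using assms(3) by blast
  have "v \<in> S" if v: "v \<in> pverts G" for v
  proof -
    have "u \<in> pverts G" using u assms(2) by blast
    then obtain p where "awalk u p v" using ex_awalk[OF assms(1) _ v] by blast
    then show ?thesis using u assms(4) by (rule awalk_stays_in_closed_set)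
  qed
  then show ?thesis using assms(2) by blast
qed

lemma path_dist_le_1_iff:
  assumes con: "Digraph_Component.connected (with_proj G)" and "u \<in> pverts G" "v \<in> pverts G"
  shows "path_dist G u v \<le> 1 \<longleftrightarrow> v = u \<or> (u, v) \<in> parcs G"
proof
  assume le: "path_dist G u v \<le> 1"
  obtain r where "awalk u r v" using ex_awalk[OF assms] ..
  then obtain p where p: "awalk u p v" "path_dist G u v = length p" by (rule path_dist_witness)
  then have "length p \<le> 1" using le by simp
  then consider "p = []" | e where "p = [e]" by (cases p) auto
  then show "v = u \<or> (u, v) \<in> parcs G"
    using p(1) by cases (auto simp: awalk_Nil_iff awalk_Cons_iff)
next
  assume "v = u \<or> (u, v) \<in> parcs G"
  then consider "awalk u [] v" | "awalk u [(u, v)] v"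
    using assms by (auto simp: awalk_Nil_iff awalk_Cons_iff)
  then show "path_dist G u v \<le> 1"
    by cases (auto dest: path_dist_le)
qed

text \<open>
  The image of a shortest walk under a graph homomorphism is a walk of the same length; applied to
  an automorphism and to its inverse this gives both inequalities of an isometry.
\<close>
lemma path_dist_image_le:
  assumes con: "Digraph_Component.connected (with_proj G)"
    and H: "pair_bidirected_digraph H"
    and vert: "\<And>x. x \<in> pverts G \<Longrightarrow> f x \<in> pverts H"
    and arc: "\<And>x y. (x, y) \<in> parcs G \<Longrightarrow> (f x, f y) \<in> parcs H"
    and uv: "u \<in> pverts G" "v \<in> pverts G"
  shows "path_dist H (f u) (f v) \<le> path_dist G u v"
proof -
  interpret H: pair_bidirected_digraph H by (rule H)
  have walk: "H.awalk (f x) (map (map_prod f f) p) (f y)" if "awalk x p y" for x p y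
    using that
    by (induction p arbitrary: x)
       (auto simp: awalk_Nil_iff H.awalk_Nil_iff awalk_Cons_iff H.awalk_Cons_iff vert arc)
  obtain r where "awalk u r v" using ex_awalk[OF con uv] ..
  then obtain p where p: "awalk u p v" "path_dist G u v = length p" by (rule path_dist_witness)
  show ?thesis using H.path_dist_le[OF walk[OF p(1)]] p(2) by simp
qed

lemma path_dist_automorphism:
  assumes con: "Digraph_Component.connected (with_proj G)"
    and bij: "bij_betw f (pverts G) (pverts G)"
    and arc: "\<And>x y. x \<in> pverts G \<Longrightarrow> y \<in> pverts G \<Longrightarrow> (f x, f y) \<in> parcs G \<longleftrightarrow> (x, y) \<in> parcs G"
    and uv: "u \<in> pverts G" "v \<in> pverts G"
  shows "path_dist G (f u) (f v) = path_dist G u v"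
proof -
  let ?g = "inv_into (pverts G) f"
  have G: "pair_bidirected_digraph G" ..
  have fV: "f x \<in> pverts G" if "x \<in> pverts G" for x using bij that by (rule bij_betw_apply)
  have gV: "?g x \<in> pverts G" if "x \<in> pverts G" for x
    using bij_betw_inv_into[OF bij] that by (rule bij_betw_apply)
  have "path_dist G (f u) (f v) \<le> path_dist G u v"
    by (rule path_dist_image_le[OF con G fV _ uv]) (use arc in_arcsD1 in_arcsD2 in blast)+
  moreover have "path_dist G (?g (f u)) (?g (f v)) \<le> path_dist G (f u) (f v)"
  proof (rule path_dist_image_le[OF con G gV _ fV[OF uv(1)] fV[OF uv(2)]])
    fix x y assume "(x, y) \<in> parcs G"
    moreover from this have "x \<in> pverts G" "y \<in> pverts G" using in_arcsD1 in_arcsD2 by blast+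
    ultimately show "(?g x, ?g y) \<in> parcs G"
      using arc[OF gV gV] bij_betw_inv_into_right[OF bij] by simp
  qed
  ultimately show ?thesis using bij_betw_inv_into_left[OF bij] uv by simp
qed

end

section \<open>The Hausdorff distance of finite sets\<close>

lemma finite_INF_le_iff:
  fixes f :: "'b \<Rightarrow> real"
  assumes "finite B" "B \<noteq> {}"
  shows "(INF b\<in>B. f b) \<le> c \<longleftrightarrow> (\<exists>b\<in>B. f b \<le> c)"
  using assms by (simp add: cInf_eq_Min Min_le_iff)

lemma hausdorff_dist_le_iff:
  assumes "finite A" "A \<noteq> {}" "finite B" "B \<noteq> {}"
  shows "hausdorff_dist d A B \<le> c \<longleftrightarrow>
    (\<forall>a\<in>A. \<exists>b\<in>B. d a b \<le> c) \<and> (\<forall>b\<in>B. \<exists>a\<in>A. d a b \<le> c)"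
  using assms unfolding hausdorff_dist_def
  by (simp add: finite_INF_le_iff cSUP_le_iff)

lemma card_nonempty_subsets:
  "finite S \<Longrightarrow> card {A. A \<subseteq> S \<and> A \<noteq> {} \<and> finite A} = 2 ^ card S - 1"
proof -
  assume "finite S"
  moreover from this have "{A. A \<subseteq> S \<and> A \<noteq> {} \<and> finite A} = Pow S - {{}}"
    by (auto intro: finite_subset)
  ultimately show ?thesis by (simp add: card_Pow)
qed

section \<open>Closed neighbourhoods and twin classes in a regular graph\<close>

locale regular_connected_graph = pair_bidirected_digraph G for G :: "'a pair_pre_digraph" +
  fixes k :: nat
  assumes connected: "Digraph_Component.connected (with_proj G)"
    and locally_finite: "locally_finite G"
    and regular: "regular k G"
begin

abbreviation V where "V \<equiv> pverts G"

abbreviation Q where "Q \<equiv> twin_quotient G"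

definition nbhd :: "'a \<Rightarrow> 'a set" where
  "nbhd v = {w \<in> V. w = v \<or> (v, w) \<in> parcs G}"

lemma nbhd_subset: "nbhd v \<subseteq> V"
  by (auto simp: nbhd_def)

lemma self_in_nbhd: "v \<in> V \<Longrightarrow> v \<in> nbhd v"
  by (auto simp: nbhd_def)

lemma nbhd_sym: "u \<in> V \<Longrightarrow> v \<in> nbhd u \<Longrightarrow> u \<in> nbhd v"
  using pair_sym_arcs by (auto simp: nbhd_def symmetric_def sym_def)

lemma nbhd_eq_insert:
  assumes "v \<in> V"
  shows "nbhd v = insert v (snd ` out_arcs (with_proj G) v)"
  using assms in_arcsD2 by (force simp: nbhd_def out_arcs_def)

lemma finite_nbhd: "v \<in> V \<Longrightarrow> finite (nbhd v)"
  using locally_finite by (simp add: nbhd_eq_insert locally_finite_def)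

lemma card_nbhd: "v \<in> V \<Longrightarrow> card (nbhd v) = Suc k"
proof -
  assume v: "v \<in> V"
  have "inj_on snd (out_arcs (with_proj G) v)"
    by (auto simp: out_arcs_def inj_on_def)
  then have "card (snd ` out_arcs (with_proj G) v) = k"
    using v regular by (simp add: card_image regular_def out_degree_def)
  moreover have "v \<notin> snd ` out_arcs (with_proj G) v"
    using no_loops by (auto simp: out_arcs_def)
  ultimately show ?thesis
    using v locally_finite by (simp add: nbhd_eq_insert locally_finite_def)
qed

lemma mcball_eq_nbhd:
  assumes "v \<in> V"
  shows "Metric_space.mcball V (path_dist G) v 1 = nbhd v"
proof -
  interpret M: Metric_space V "path_dist G" by (rule Metric_space_path_dist[OF connected])
  show ?thesis using assms path_dist_le_1_iff[OF connected] by (auto simp: nbhd_def)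
qed

lemma twin_rel_iff: "(u, v) \<in> twin_rel G \<longleftrightarrow> u \<in> V \<and> v \<in> V \<and> nbhd u = nbhd v"
  by (auto simp: twin_rel_def mcball_eq_nbhd)

lemma pverts_Q: "pverts Q = V // twin_rel G"
  by (simp add: twin_quotient_def)

lemma arc_Q_iff:
  "(C, D) \<in> parcs Q \<longleftrightarrow>
    C \<in> pverts Q \<and> D \<in> pverts Q \<and> C \<noteq> D \<and> (\<exists>u\<in>C. \<exists>v\<in>D. (u, v) \<in> parcs G)"
  by (auto simp: twin_quotient_def)

lemma class_of_in_Q: "v \<in> V \<Longrightarrow> twin_rel G `` {v} \<in> pverts Q"
  by (auto simp: pverts_Q intro: quotientI)

lemma class_eq:
  assumes "C \<in> pverts Q" "v \<in> C"
  shows "C = {w \<in> V. nbhd w = nbhd v}" "v \<in> V"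
  using assms by (auto simp: pverts_Q twin_rel_iff elim!: quotientE)

lemma class_subset: "C \<in> pverts Q \<Longrightarrow> C \<subseteq> V"
  using class_eq by blast

lemma class_nonempty: "C \<in> pverts Q \<Longrightarrow> C \<noteq> {}"
  using in_quotient_imp_non_empty[OF equiv_twin_rel] by (simp add: pverts_Q)

lemma class_nbhd_eq: "C \<in> pverts Q \<Longrightarrow> u \<in> C \<Longrightarrow> v \<in> C \<Longrightarrow> nbhd u = nbhd v"
  using class_eq by blast

lemma class_eqI:
  "C \<in> pverts Q \<Longrightarrow> D \<in> pverts Q \<Longrightarrow> u \<in> C \<Longrightarrow> v \<in> D \<Longrightarrow> nbhd u = nbhd v \<Longrightarrow> C = D"
  using class_eq(1)[of C u] class_eq(1)[of D v] by simp

lemma finite_class: "C \<in> pverts Q \<Longrightarrow> finite C"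
  using finite_twin_class[OF connected locally_finite] .

lemma hyperspace_iff: "C \<subseteq> V \<Longrightarrow> A \<in> hyperspace G C \<longleftrightarrow> A \<subseteq> C \<and> A \<noteq> {} \<and> finite A"
  by (simp add: hyperspace_eq_finite[OF connected])

lemma hyperspace_class_iff:
  "C \<in> pverts Q \<Longrightarrow> A \<in> hyperspace G C \<longleftrightarrow> A \<subseteq> C \<and> A \<noteq> {} \<and> finite A"
  by (rule hyperspace_iff[OF class_subset])

abbreviation K where "K \<equiv> hyperspace G V"

lemma K_iff: "A \<in> K \<longleftrightarrow> A \<subseteq> V \<and> A \<noteq> {} \<and> finite A"
  by (simp add: hyperspace_iff)

lemma class_in_hyperspace: "C \<in> pverts Q \<Longrightarrow> C \<in> hyperspace G C"
  by (simp add: hyperspace_class_iff class_nonempty finite_class)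

lemma hyperspace_class_subset: "C \<in> pverts Q \<Longrightarrow> hyperspace G C \<subseteq> K"
  using class_subset[of C] by (force simp: hyperspace_class_iff K_iff)

lemma finite_hyperspace_class: "C \<in> pverts Q \<Longrightarrow> finite (hyperspace G C)"
  by (rule finite_subset[of _ "Pow C"]) (auto simp: hyperspace_class_iff finite_class)

lemma card_hyperspace_class: "C \<in> pverts Q \<Longrightarrow> card (hyperspace G C) = 2 ^ card C - 1"
  using card_nonempty_subsets[OF finite_class]
  by (simp add: hyperspace_eq_finite[OF connected class_subset])

section \<open>Unit balls of the hyperspace\<close>

text \<open>
  For nonempty finite vertex sets this is Hausdorff distance at most 1; see
  \<open>hausdorff_dist_le_1_iff\<close>.
\<close>
definition near :: "'a set \<Rightarrow> 'a set \<Rightarrow> bool" where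
  "near A B \<longleftrightarrow> (\<forall>a\<in>A. nbhd a \<inter> B \<noteq> {}) \<and> (\<forall>b\<in>B. nbhd b \<inter> A \<noteq> {})"

definition unit_ball :: "'a set \<Rightarrow> 'a set set" where
  "unit_ball A = {B \<in> K. near A B}"

lemma hausdorff_dist_le_1_iff:
  assumes "A \<in> K" "B \<in> K"
  shows "hausdorff_dist (path_dist G) A B \<le> 1 \<longleftrightarrow> near A B"
proof -
  have dist: "path_dist G a b \<le> 1 \<longleftrightarrow> b \<in> nbhd a" "path_dist G a b \<le> 1 \<longleftrightarrow> a \<in> nbhd b"
    if "a \<in> A" "b \<in> B" for a b
  proof -
    have ab: "a \<in> V" "b \<in> V" using that assms by (auto simp: K_iff)
    show "path_dist G a b \<le> 1 \<longleftrightarrow> b \<in> nbhd a"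
      using path_dist_le_1_iff[OF connected ab] ab by (auto simp: nbhd_def)
    then show "path_dist G a b \<le> 1 \<longleftrightarrow> a \<in> nbhd b" using nbhd_sym ab by blast
  qed
  have "hausdorff_dist (path_dist G) A B \<le> 1 \<longleftrightarrow>
     (\<forall>a\<in>A. \<exists>b\<in>B. path_dist G a b \<le> 1) \<and> (\<forall>b\<in>B. \<exists>a\<in>A. path_dist G a b \<le> 1)"
    using assms by (simp add: hausdorff_dist_le_iff K_iff)
  also have "\<dots> \<longleftrightarrow> (\<forall>a\<in>A. \<exists>b\<in>B. b \<in> nbhd a) \<and> (\<forall>b\<in>B. \<exists>a\<in>A. a \<in> nbhd b)"
    by (intro arg_cong2[where f = "(\<and>)"] ball_cong bex_cong refl) (use dist in auto)
  finally show ?thesis unfolding near_def by blast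
qed

lemma near_imp_subset_Union: "A \<subseteq> V \<Longrightarrow> B \<subseteq> V \<Longrightarrow> near A B \<Longrightarrow> B \<subseteq> (\<Union>a\<in>A. nbhd a)"
  using nbhd_sym unfolding near_def by blast

lemma finite_unit_ball:
  assumes "A \<in> K"
  shows "finite (unit_ball A)"
proof (rule finite_subset)
  show "unit_ball A \<subseteq> Pow (\<Union>a\<in>A. nbhd a)"
    using near_imp_subset_Union assms by (auto simp: unit_ball_def K_iff)
  show "finite (Pow (\<Union>a\<in>A. nbhd a))"
    using assms finite_nbhd by (auto simp: K_iff)
qed

text \<open>
  All members of \<open>A\<close> have the closed neighbourhood \<open>nbhd c\<close>, so any single vertex of \<open>B\<close> is close
  to all of \<open>A\<close>, and \<open>B \<subseteq> nbhd c\<close> is the only condition left.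
\<close>
lemma unit_ball_of_twins:
  assumes C: "C \<in> pverts Q" "A \<in> hyperspace G C" "c \<in> C"
  shows "unit_ball A = {B. B \<subseteq> nbhd c \<and> B \<noteq> {} \<and> finite B}"
proof -
  have A: "A \<subseteq> C" "A \<noteq> {}" using C by (auto simp: hyperspace_class_iff)
  then have AV: "A \<subseteq> V" using class_subset[OF C(1)] by blast
  have eq: "nbhd a = nbhd c" if "a \<in> A" for a using that A class_nbhd_eq C by blast
  show ?thesis
  proof (intro set_eqI iffI)
    fix B assume B: "B \<in> unit_ball A"
    then have "B \<subseteq> (\<Union>a\<in>A. nbhd a)" using AV near_imp_subset_Union by (auto simp: unit_ball_def K_iff)
    then have "B \<subseteq> nbhd c" using eq by blast
    then show "B \<in> {B. B \<subseteq> nbhd c \<and> B \<noteq> {} \<and> finite B}" using B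
      by (simp add: unit_ball_def K_iff)
  next
    fix B assume B: "B \<in> {B. B \<subseteq> nbhd c \<and> B \<noteq> {} \<and> finite B}"
    then have BV: "B \<subseteq> V" using nbhd_subset by blast
    have "nbhd a \<inter> B \<noteq> {}" if "a \<in> A" for a using B eq[OF that] by auto
    moreover have "nbhd b \<inter> A \<noteq> {}" if b: "b \<in> B" for b
    proof -
      obtain a where a: "a \<in> A" using A by blast
      then have "b \<in> nbhd a" using B b eq by auto
      then show ?thesis using nbhd_sym a AV by blast
    qed
    ultimately show "B \<in> unit_ball A" using B BV by (auto simp: unit_ball_def K_iff near_def)
  qed
qed

lemma card_unit_ball_of_twins:
  assumes "C \<in> pverts Q" "A \<in> hyperspace G C"
  shows "card (unit_ball A) = 2 ^ Suc k - 1"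
proof -
  obtain c where c: "c \<in> C" using class_nonempty assms by blast
  then have "c \<in> V" using class_subset assms by blast
  then show ?thesis
    using unit_ball_of_twins[OF assms c] card_nonempty_subsets[OF finite_nbhd] card_nbhd by simp
qed

text \<open>The union of the sets in the ball is the common closed neighbourhood of the class.\<close>
lemma unit_ball_determines_class:
  assumes "C \<in> pverts Q" "A \<in> hyperspace G C" "D \<in> pverts Q" "B \<in> hyperspace G D"
  shows "unit_ball A = unit_ball B \<longleftrightarrow> C = D"
proof -
  obtain c d where cd: "c \<in> C" "d \<in> D" using class_nonempty assms by blast
  then have V: "c \<in> V" "d \<in> V" using class_subset assms by blast+
  have "\<Union>{B. B \<subseteq> nbhd v \<and> B \<noteq> {} \<and> finite B} = nbhd v" for v by blast
  then have "unit_ball A = unit_ball B \<longleftrightarrow> nbhd c = nbhd d"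
    using unit_ball_of_twins[OF assms(1,2) cd(1)] unit_ball_of_twins[OF assms(3,4) cd(2)] by metis
  also have "\<dots> \<longleftrightarrow> C = D"
    using class_eqI[OF assms(1,3) cd] class_nbhd_eq[OF assms(1)] cd by blast
  finally show ?thesis .
qed

lemma near_twin_sets_iff:
  assumes "C \<in> pverts Q" "A \<in> hyperspace G C" "D \<in> pverts Q" "B \<in> hyperspace G D"
  shows "near A B \<longleftrightarrow> C = D \<or> (C, D) \<in> parcs Q"
proof -
  have A: "A \<subseteq> C" "A \<noteq> {}" and B: "B \<subseteq> D" "B \<noteq> {}" "finite B"
    using assms by (auto simp: hyperspace_class_iff)
  obtain a b where ab: "a \<in> A" "b \<in> B" using A B by blast
  have V: "C \<subseteq> V" "D \<subseteq> V" using class_subset assms by auto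
  show ?thesis
  proof
    assume "near A B"
    then obtain b' where "b' \<in> B" "b' \<in> nbhd a" using ab by (auto simp: near_def)
    then have b': "b' \<in> D" "a \<in> C" "b' = a \<or> (a, b') \<in> parcs G"
      using A B ab by (auto simp: nbhd_def)
    then show "C = D \<or> (C, D) \<in> parcs Q"
      using class_eqI[OF assms(1,3) b'(2)] assms(1,3) unfolding arc_Q_iff by blast
  next
    assume "C = D \<or> (C, D) \<in> parcs Q"
    then have "\<exists>u\<in>C. \<exists>v\<in>D. v \<in> nbhd u"
    proof
      assume "C = D"
      then show ?thesis using ab(1) A(1) self_in_nbhd V by blast
    next
      assume "(C, D) \<in> parcs Q"
      then obtain u v where "u \<in> C" "v \<in> D" "(u, v) \<in> parcs G" unfolding arc_Q_iff by blast
      then show ?thesis using V by (auto simp: nbhd_def)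
    qed
    then obtain u v where uv: "u \<in> C" "v \<in> D" "v \<in> nbhd u" by blast
    then have "B \<subseteq> nbhd u"
    proof -
      have "nbhd y = nbhd v" if "y \<in> B" for y using that B uv class_nbhd_eq assms by blast
      moreover have "u \<in> nbhd v" using uv V nbhd_sym by blast
      ultimately show ?thesis using nbhd_sym B V by blast
    qed
    then show "near A B"
      using unit_ball_of_twins[OF assms(1,2) uv(1)] B by (auto simp: unit_ball_def)
  qed
qed

text \<open>
  Let \<open>N\<close> be the union of the closed neighbourhoods of the members of \<open>A\<close>. A subset of \<open>N\<close> is
  in the ball if it meets all these neighbourhoods. Adding \<open>N - nbhd a\<close> to a nonempty subset of
  \<open>nbhd a\<close> gives such a set: any other neighbourhood has the same size as \<open>nbhd a\<close> and therefore
  sticks out of it. This already yields \<open>2 ^ (k + 1) - 1\<close> sets, all of which contain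
  \<open>N - nbhd a\<close>; removing from \<open>N\<close> one vertex outside \<open>nbhd a\<close> gives a further one.
\<close>
lemma card_unit_ball_non_twins:
  assumes A: "A \<in> K" and a: "a \<in> A" and b: "b \<in> A" and ne: "nbhd a \<noteq> nbhd b"
  shows "2 ^ Suc k - 1 < card (unit_ball A)"
proof -
  let ?N = "\<Union>x\<in>A. nbhd x"
  let ?P = "{B. B \<subseteq> nbhd a \<and> B \<noteq> {} \<and> finite B}"
  let ?f = "\<lambda>B. B \<union> (?N - nbhd a)"
  have AV: "A \<subseteq> V" using A by (simp add: K_iff)
  then have inV: "x \<in> V" if "x \<in> A" for x using that by blast
  have NV: "?N \<subseteq> V" using nbhd_subset by blast
  have fin: "finite ?N" using A finite_nbhd by (auto simp: K_iff)
  have excess: "nbhd x - nbhd a \<noteq> {}" if x: "x \<in> A" "nbhd x \<noteq> nbhd a" for x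
  proof
    assume "nbhd x - nbhd a = {}"
    then have "nbhd x \<subseteq> nbhd a" by blast
    moreover have "card (nbhd x) = card (nbhd a)" using card_nbhd inV x(1) a by simp
    ultimately show False using card_subset_eq[OF finite_nbhd[OF inV[OF a]]] x(2) by blast
  qed
  have mem: "B \<in> unit_ball A" if "B \<subseteq> ?N" "\<And>x. x \<in> A \<Longrightarrow> nbhd x \<inter> B \<noteq> {}" for B
  proof -
    have "nbhd y \<inter> A \<noteq> {}" if "y \<in> B" for y
      using that \<open>B \<subseteq> ?N\<close> nbhd_sym AV by blast
    moreover have "B \<noteq> {}" using that(2)[OF a] by blast
    ultimately show ?thesis
      using that fin NV by (auto simp: unit_ball_def K_iff near_def intro: finite_subset)
  qed
  have sub: "?f ` ?P \<subseteq> unit_ball A"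
  proof (rule image_subsetI)
    fix B assume B: "B \<in> ?P"
    show "?f B \<in> unit_ball A"
    proof (rule mem)
      show "?f B \<subseteq> ?N" using B a by blast
      fix x assume x: "x \<in> A"
      show "nbhd x \<inter> ?f B \<noteq> {}"
      proof (cases "nbhd x = nbhd a")
        case True
        then show ?thesis using B by auto
      next
        case False
        then show ?thesis using excess[OF x False] x by blast
      qed
    qed
  qed
  obtain y where y: "y \<in> nbhd b" "y \<notin> nbhd a" using excess[OF b] ne by blast
  have extra: "?N - {y} \<in> unit_ball A"
  proof (rule mem)
    fix x assume x: "x \<in> A"
    \<comment> \<open>By regularity, one isolated vertex would make all vertices isolated; a connected graph
      then has only one vertex, while \<open>a\<close> and \<open>y\<close> are distinct.\<close>
    have "nbhd x \<noteq> {y}"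
    proof
      assume "nbhd x = {y}"
      then have k: "card (nbhd v) = 1" if "v \<in> V" for v
        using card_nbhd[OF that] card_nbhd[OF inV[OF x]] by simp
      have "{a} = V"
      proof (rule closed_set_eq_pverts[OF connected])
        fix u v assume "u \<in> {a}" "(u, v) \<in> parcs G"
        then have "a \<in> nbhd a" "v \<in> nbhd a" using inV[OF a] in_arcsD2 by (auto simp: nbhd_def)
        then show "v \<in> {a}" using k[OF inV[OF a]] by (auto simp: card_1_singleton_iff)
      qed (use a AV in auto)
      moreover have "y \<in> V" using y(1) nbhd_subset by blast
      ultimately have "y = a" by auto
      then show False using y(2) self_in_nbhd[OF inV[OF a]] by simp
    qed
    moreover have "nbhd x \<noteq> {}" using x AV self_in_nbhd by blast
    ultimately show "nbhd x \<inter> (?N - {y}) \<noteq> {}" using x by blast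
  qed blast
  have y_in: "y \<in> B" if "B \<in> ?f ` ?P" for B using that y b by auto
  have notin: "?N - {y} \<notin> ?f ` ?P"
  proof
    assume "?N - {y} \<in> ?f ` ?P"
    then have "y \<in> ?N - {y}" by (rule y_in)
    then show False by simp
  qed
  have "inj_on ?f ?P" by (rule inj_on_inverseI[where g = "\<lambda>B. B \<inter> nbhd a"]) auto
  then have "card (?f ` ?P) = 2 ^ Suc k - 1"
    using card_nonempty_subsets[OF finite_nbhd] card_nbhd inV[OF a] by (simp add: card_image)
  moreover have "card (?f ` ?P) < card (unit_ball A)"
  proof (rule psubset_card_mono[OF finite_unit_ball[OF A]])
    have "?f ` ?P \<noteq> unit_ball A"
    proof
      assume eq: "?f ` ?P = unit_ball A"
      show False using notin extra by (simp only: eq simp_thms)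
    qed
    then show "?f ` ?P \<subset> unit_ball A" by (rule psubsetI[OF sub])
  qed
  ultimately show ?thesis by simp
qed

section \<open>Neighbourhoods in the twin quotient\<close>

definition quotient_nbhd :: "'a set \<Rightarrow> 'a set set" where
  "quotient_nbhd C = {D \<in> pverts Q. C = D \<or> (C, D) \<in> parcs Q}"

text \<open>
  With disjointness of the classes, this makes the class sizes in a closed neighbourhood of the
  quotient add up to the constant \<open>k + 1\<close>.
\<close>
lemma Union_quotient_nbhd:
  assumes C: "C \<in> pverts Q" "c \<in> C"
  shows "\<Union>(quotient_nbhd C) = nbhd c"
proof (intro set_eqI iffI)
  fix v assume "v \<in> \<Union>(quotient_nbhd C)"
  then obtain D where D: "D \<in> quotient_nbhd C" "v \<in> D" by blast
  then have DQ: "D \<in> pverts Q" by (simp add: quotient_nbhd_def)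
  have "{c} \<in> hyperspace G C" "{v} \<in> hyperspace G D"
    using C DQ D(2) by (auto simp: hyperspace_class_iff)
  then have "near {c} {v}" using near_twin_sets_iff C DQ D by (auto simp: quotient_nbhd_def)
  then show "v \<in> nbhd c" by (auto simp: near_def)
next
  fix v assume v: "v \<in> nbhd c"
  let ?D = "twin_rel G `` {v}"
  have V: "v \<in> V" "c \<in> V" using v nbhd_subset C class_subset by blast+
  then have D: "?D \<in> pverts Q" "v \<in> ?D" by (auto simp: class_of_in_Q twin_rel_iff)
  have "{c} \<in> hyperspace G C" "{v} \<in> hyperspace G ?D"
    using C D by (simp_all add: hyperspace_class_iff)
  moreover have "near {c} {v}" using v nbhd_sym V by (auto simp: near_def)
  ultimately have "?D \<in> quotient_nbhd C" using near_twin_sets_iff C D by (auto simp: quotient_nbhd_def)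
  then show "v \<in> \<Union>(quotient_nbhd C)" using D by blast
qed

lemma finite_quotient_nbhd:
  assumes C: "C \<in> pverts Q"
  shows "finite (quotient_nbhd C)"
proof -
  obtain c where c: "c \<in> C" "c \<in> V" using C class_nonempty class_subset by blast
  then show ?thesis using Union_quotient_nbhd[OF C c(1)] finite_nbhd finite_UnionD by metis
qed

lemma sum_card_quotient_nbhd:
  assumes C: "C \<in> pverts Q"
  shows "(\<Sum>D\<in>quotient_nbhd C. card D) = Suc k"
proof -
  obtain c where c: "c \<in> C" "c \<in> V" using C class_nonempty class_subset by blast
  have "disjoint (quotient_nbhd C)"
    using class_eqI by (auto simp: disjoint_def quotient_nbhd_def)
  then have "card (\<Union>(quotient_nbhd C)) = (\<Sum>D\<in>quotient_nbhd C. card D)"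
    by (intro card_Union_disjoint)
       (auto simp: quotient_nbhd_def finite_class disjoint_def pairwise_def disjnt_def)
  then show ?thesis using Union_quotient_nbhd[OF C c(1)] card_nbhd c by simp
qed

end

section \<open>Nonexpansive bijections of the hyperspace\<close>

locale nonexpansive_bijection = regular_connected_graph G k
  for G :: "'a pair_pre_digraph" and k +
  fixes F :: "'a set \<Rightarrow> 'a set"
  assumes bij: "bij_betw F K K"
    and nonexpansive: "\<And>A B. A \<in> K \<Longrightarrow> B \<in> K \<Longrightarrow>
      hausdorff_dist (path_dist G) (F A) (F B) \<le> hausdorff_dist (path_dist G) A B"
begin

abbreviation F_inv where "F_inv \<equiv> inv_into K F"

lemma F_in_K: "A \<in> K \<Longrightarrow> F A \<in> K"
  using bij by (rule bij_betw_apply)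

lemma F_inv_in_K: "A \<in> K \<Longrightarrow> F_inv A \<in> K"
  using bij_betw_inv_into[OF bij] by (rule bij_betw_apply)

lemma F_F_inv: "A \<in> K \<Longrightarrow> F (F_inv A) = A"
  using bij by (rule bij_betw_inv_into_right)

lemma F_inj: "inj_on F K"
  using bij by (rule bij_betw_imp_inj_on)

lemma unit_ball_subset: "unit_ball A \<subseteq> K"
  by (auto simp: unit_ball_def)

lemma F_unit_ball_subset:
  assumes A: "A \<in> K"
  shows "F ` unit_ball A \<subseteq> unit_ball (F A)"
proof (rule image_subsetI)
  fix B assume "B \<in> unit_ball A"
  then have B: "B \<in> K" "hausdorff_dist (path_dist G) A B \<le> 1"
    using A by (auto simp: unit_ball_def hausdorff_dist_le_1_iff)
  then have "hausdorff_dist (path_dist G) (F A) (F B) \<le> 1"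
    using nonexpansive[OF A B(1)] by simp
  then show "F B \<in> unit_ball (F A)"
    using A B F_in_K by (simp add: unit_ball_def hausdorff_dist_le_1_iff)
qed

text \<open>
  The ball around \<open>A\<close> embeds into the ball around \<open>F A\<close>, whose size is the least possible. So
  the ball around \<open>A\<close> has that size too, which happens only for sets of twins, and an injection
  between finite sets of equal size is onto.
\<close>
lemma preimage_of_twins:
  assumes A: "A \<in> K" and C: "C \<in> pverts Q" "F A \<in> hyperspace G C"
  shows "\<exists>D\<in>pverts Q. A \<in> hyperspace G D"
    and "F ` unit_ball A = unit_ball (F A)"
proof -
  have inj: "inj_on F (unit_ball A)" using F_inj unit_ball_subset by (rule inj_on_subset)
  have fin: "finite (unit_ball (F A))" using finite_unit_ball F_in_K A by blast
  have "card (unit_ball A) \<le> card (unit_ball (F A))"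
    using card_inj_on_le[OF inj F_unit_ball_subset[OF A] fin] .
  then have le: "card (unit_ball A) \<le> 2 ^ Suc k - 1" using card_unit_ball_of_twins[OF C] by simp
  obtain a where a: "a \<in> A" "a \<in> V" using A by (auto simp: K_iff)
  have "A \<subseteq> twin_rel G `` {a}"
  proof
    fix x assume x: "x \<in> A"
    have "nbhd a = nbhd x"
      using card_unit_ball_non_twins[OF A a(1) x] le by fastforce
    then show "x \<in> twin_rel G `` {a}" using A x a(2) by (auto simp: K_iff twin_rel_iff)
  qed
  then have D: "A \<in> hyperspace G (twin_rel G `` {a})"
    using A by (simp add: hyperspace_class_iff[OF class_of_in_Q[OF a(2)]] K_iff)
  then show "\<exists>D\<in>pverts Q. A \<in> hyperspace G D" using class_of_in_Q[OF a(2)] by blast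
  have "card (F ` unit_ball A) = card (unit_ball (F A))"
    using card_unit_ball_of_twins[OF C] card_unit_ball_of_twins[OF class_of_in_Q[OF a(2)] D]
    by (simp add: card_image[OF inj])
  then show "F ` unit_ball A = unit_ball (F A)"
    using card_subset_eq[OF fin F_unit_ball_subset[OF A]] by blast
qed

text \<open>
  A nonexpansive map need not reflect closeness; here it does because \<open>F\<close> is injective and maps
  the ball around \<open>A\<close> onto the whole ball around \<open>F A\<close>.
\<close>
lemma near_F_iff:
  assumes A: "A \<in> K" "C \<in> pverts Q" "F A \<in> hyperspace G C" and B: "B \<in> K"
  shows "near (F A) (F B) \<longleftrightarrow> near A B"
proof -
  have "near (F A) (F B) \<longleftrightarrow> F B \<in> F ` unit_ball A"
    using preimage_of_twins(2)[OF A] F_in_K[OF B] by (simp add: unit_ball_def)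
  also have "\<dots> \<longleftrightarrow> near A B"
    using inj_on_image_mem_iff[OF F_inj B unit_ball_subset] B by (simp add: unit_ball_def)
  finally show ?thesis .
qed

text \<open>
  The class \<open>C\<close>, as a point of the hyperspace, serves as representative of all its nonempty
  subsets: its preimage consists of mutual twins, whose class is the value of the map.
\<close>
definition class_map :: "'a set \<Rightarrow> 'a set" where
  "class_map C = twin_rel G `` F_inv C"

lemma class_in_K: "C \<in> pverts Q \<Longrightarrow> C \<in> K"
  using class_in_hyperspace hyperspace_class_subset by blast

lemma class_map:
  assumes C: "C \<in> pverts Q"
  shows "class_map C \<in> pverts Q" "F_inv C \<in> hyperspace G (class_map C)"
proof -
  have K: "C \<in> K" using class_in_K C .
  obtain D where D: "D \<in> pverts Q" "F_inv C \<in> hyperspace G D"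
    using preimage_of_twins(1)[OF F_inv_in_K[OF K] C] class_in_hyperspace C F_F_inv[OF K] by auto
  then obtain a where a: "a \<in> F_inv C" "F_inv C \<subseteq> D" by (auto simp: hyperspace_class_iff)
  have "twin_rel G `` F_inv C = D"
  proof (intro set_eqI iffI)
    fix w assume "w \<in> twin_rel G `` F_inv C"
    then obtain x where x: "x \<in> F_inv C" "w \<in> V" "nbhd x = nbhd w" by (auto simp: twin_rel_iff)
    then have "x \<in> D" using a by blast
    have "w \<in> {v \<in> V. nbhd v = nbhd x}" using x by simp
    then show "w \<in> D" using class_eq(1)[OF D(1) \<open>x \<in> D\<close>] by simp
  next
    fix w assume w: "w \<in> D"
    then have "nbhd a = nbhd w" using a by (intro class_nbhd_eq[OF D(1)]) auto
    then have "(a, w) \<in> twin_rel G" using a w class_subset[OF D(1)] by (auto simp: twin_rel_iff)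
    then show "w \<in> twin_rel G `` F_inv C" using a by blast
  qed
  then show "class_map C \<in> pverts Q" "F_inv C \<in> hyperspace G (class_map C)"
    using D by (auto simp: class_map_def)
qed

text \<open>
  All nonempty subsets of \<open>C\<close> have the same unit ball as \<open>C\<close>. Pulled back along \<open>F\<close>, this
  says that their preimages share the unit ball of the preimage of \<open>C\<close>, hence its class.
\<close>
lemma preimage_hyperspace_subset:
  assumes C: "C \<in> pverts Q"
  shows "{A \<in> K. F A \<in> hyperspace G C} \<subseteq> hyperspace G (class_map C)"
proof
  fix A assume "A \<in> {A \<in> K. F A \<in> hyperspace G C}"
  then have A: "A \<in> K" "F A \<in> hyperspace G C" by auto
  have K: "C \<in> K" using class_in_K C .
  obtain D where D: "D \<in> pverts Q" "A \<in> hyperspace G D"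
    using preimage_of_twins(1)[OF A(1) C A(2)] by blast
  have "F ` unit_ball A = unit_ball (F A)" using preimage_of_twins(2) A C by blast
  also have "\<dots> = unit_ball C"
    using unit_ball_determines_class C A(2) class_in_hyperspace by blast
  also have "\<dots> = F ` unit_ball (F_inv C)"
    using preimage_of_twins(2)[OF F_inv_in_K[OF K] C] class_in_hyperspace[OF C] F_F_inv[OF K] by simp
  finally have "unit_ball A = unit_ball (F_inv C)"
    by (simp only: inj_on_image_eq_iff[OF F_inj unit_ball_subset unit_ball_subset])
  then have "D = class_map C"
    using unit_ball_determines_class D class_map[OF C] by blast
  then show "A \<in> hyperspace G (class_map C)" using D by simp
qed

lemma card_preimage_hyperspace:
  assumes C: "C \<in> pverts Q"
  shows "card {A \<in> K. F A \<in> hyperspace G C} = 2 ^ card C - 1"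
proof -
  have "F ` {A \<in> K. F A \<in> hyperspace G C} = hyperspace G C"
    using hyperspace_class_subset[OF C] F_F_inv F_inv_in_K by (force simp: image_iff)
  moreover have "inj_on F {A \<in> K. F A \<in> hyperspace G C}"
    using F_inj by (rule inj_on_subset) blast
  ultimately show ?thesis using card_image card_hyperspace_class[OF C] by metis
qed

lemma card_class_le:
  assumes C: "C \<in> pverts Q"
  shows "card C \<le> card (class_map C)"
proof -
  have q: "class_map C \<in> pverts Q" using class_map C by blast
  have "card {A \<in> K. F A \<in> hyperspace G C} \<le> card (hyperspace G (class_map C))"
    by (rule card_mono[OF finite_hyperspace_class[OF q] preimage_hyperspace_subset[OF C]])
  then have "(2::nat) ^ card C - 1 \<le> 2 ^ card (class_map C) - 1"
    by (simp only: card_preimage_hyperspace[OF C] card_hyperspace_class[OF q])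
  then have "(2::nat) ^ card C \<le> 2 ^ card (class_map C)"
    by (simp add: le_diff_conv)
  then show ?thesis by (simp only: power_increasing_iff[of "2::nat"])
qed

lemma class_map_adj_iff:
  assumes "C \<in> pverts Q" "D \<in> pverts Q"
  shows "class_map C = class_map D \<or> (class_map C, class_map D) \<in> parcs Q \<longleftrightarrow>
         C = D \<or> (C, D) \<in> parcs Q"
proof -
  have K: "C \<in> K" "D \<in> K" using class_in_K assms by auto
  have "near (F_inv C) (F_inv D) \<longleftrightarrow> near C D"
    using near_F_iff[OF F_inv_in_K[OF K(1)] assms(1) _ F_inv_in_K[OF K(2)]] F_F_inv K
      class_in_hyperspace assms by simp
  then show ?thesis
    using near_twin_sets_iff[OF class_map[OF assms(1)] class_map[OF assms(2)]]
      near_twin_sets_iff[OF assms(1) class_in_hyperspace assms(2) class_in_hyperspace] assms by simp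
qed

lemma inj_class_map: "inj_on class_map (pverts Q)"
proof (rule inj_onI)
  fix C D assume CD: "C \<in> pverts Q" "D \<in> pverts Q" "class_map C = class_map D"
  have ball: "unit_ball X = F ` unit_ball (F_inv X)" if "X \<in> pverts Q" for X
    using preimage_of_twins(2)[OF F_inv_in_K that] class_in_K class_in_hyperspace F_F_inv that by simp
  have "F_inv D \<in> hyperspace G (class_map C)" using class_map(2)[OF CD(2)] CD(3) by simp
  then have "unit_ball (F_inv C) = unit_ball (F_inv D)"
    using unit_ball_determines_class class_map[OF CD(1)] by blast
  then have "unit_ball C = unit_ball D" using ball[OF CD(1)] ball[OF CD(2)] by simp
  then show "C = D" using unit_ball_determines_class CD(1,2) class_in_hyperspace by blast
qed

text \<open>
  The class sizes in the two neighbourhoods have the same sum \<open>k + 1\<close>. Since the map does not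
  decrease sizes and is injective, a class missed by the image, or a strict increase of one size,
  would make the second sum larger.
\<close>
lemma class_map_local_bijection:
  assumes C: "C \<in> pverts Q"
  shows "class_map ` quotient_nbhd C = quotient_nbhd (class_map C)"
    and "card (class_map C) = card C"
proof -
  let ?S = "quotient_nbhd C" and ?T = "quotient_nbhd (class_map C)"
  have qC: "class_map C \<in> pverts Q" using class_map C by blast
  have S: "D \<in> pverts Q" if "D \<in> ?S" for D using that by (simp add: quotient_nbhd_def)
  have T: "0 < card E" if "E \<in> ?T" for E
    using that finite_class class_nonempty by (auto simp: quotient_nbhd_def card_gt_0_iff)
  have sub: "class_map ` ?S \<subseteq> ?T"
    using class_map_adj_iff[OF C] class_map by (auto simp: quotient_nbhd_def)
  have inj: "inj_on class_map ?S"
    using inj_class_map by (rule inj_on_subset) (use S in blast)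
  have total: "(\<Sum>E\<in>?T. card E) = (\<Sum>D\<in>?S. card D)"
    using sum_card_quotient_nbhd C qC by simp
  have le: "(\<Sum>D\<in>?S. card D) \<le> (\<Sum>D\<in>?S. card (class_map D))"
    by (rule sum_mono) (use card_class_le S in blast)
  have image: "(\<Sum>E\<in>class_map ` ?S. card E) = (\<Sum>D\<in>?S. card (class_map D))"
    using sum.reindex[OF inj] by simp
  have "(\<Sum>E\<in>?T. card E) = (\<Sum>E\<in>?T - class_map ` ?S. card E) + (\<Sum>E\<in>class_map ` ?S. card E)"
    using sum.subset_diff[OF sub finite_quotient_nbhd[OF qC]] .
  then have zero: "(\<Sum>E\<in>?T - class_map ` ?S. card E) = 0"
    and eq: "(\<Sum>D\<in>?S. card D) = (\<Sum>D\<in>?S. card (class_map D))"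
    using total le image by linarith+
  have "card E = 0" if "E \<in> ?T - class_map ` ?S" for E
    using zero that finite_quotient_nbhd[OF qC] by (subst (asm) sum_eq_0_iff) auto
  then have "?T - class_map ` ?S = {}" using T by fastforce
  then show "class_map ` ?S = ?T" using sub by blast
  have "C \<in> ?S" using C by (simp add: quotient_nbhd_def)
  then show "card (class_map C) = card C"
    using sum_mono_inv[OF eq card_class_le[OF S] _ finite_quotient_nbhd[OF C]] by simp
qed

text \<open>
  By the local bijection the image contains all neighbours of its members, so it is a union of
  connected components of the connected graph \<open>Q\<close>.
\<close>
lemma bij_class_map: "bij_betw class_map (pverts Q) (pverts Q)"
proof -
  interpret Q: pair_bidirected_digraph Q by (rule pair_bidirected_digraph_twin_quotient)
  have "class_map ` pverts Q = pverts Q"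
  proof (rule Q.closed_set_eq_pverts[OF connected_twin_quotient[OF connected]])
    show "class_map ` pverts Q \<subseteq> pverts Q" using class_map by blast
    have "V \<noteq> {}"
      using connected
      by (auto simp: Digraph_Component.connected_def strongly_connected_def mk_symmetric_def)
    then show "class_map ` pverts Q \<noteq> {}" using class_of_in_Q by blast
    fix C' D assume "C' \<in> class_map ` pverts Q" and arc: "(C', D) \<in> parcs Q"
    then obtain C where C: "C \<in> pverts Q" "C' = class_map C" by blast
    have "D \<in> quotient_nbhd C'" using arc by (auto simp: quotient_nbhd_def arc_Q_iff)
    then have "D \<in> class_map ` quotient_nbhd C" using class_map_local_bijection(1) C by simp
    then show "D \<in> class_map ` pverts Q" by (auto simp: quotient_nbhd_def)
  qed
  then show ?thesis using inj_class_map by (simp add: bij_betw_def)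
qed

lemma path_dist_class_map:
  assumes "C \<in> pverts Q" "D \<in> pverts Q"
  shows "path_dist Q (class_map C) (class_map D) = path_dist Q C D"
proof -
  interpret Q: pair_bidirected_digraph Q by (rule pair_bidirected_digraph_twin_quotient)
  have "(class_map X, class_map Y) \<in> parcs Q \<longleftrightarrow> (X, Y) \<in> parcs Q"
    if "X \<in> pverts Q" "Y \<in> pverts Q" for X Y
    using class_map_adj_iff[OF that] inj_onD[OF inj_class_map] that by (auto simp: arc_Q_iff)
  then show ?thesis
    using Q.path_dist_automorphism[OF connected_twin_quotient[OF connected] bij_class_map] assms
    by blast
qed

lemma preimage_hyperspace_eq:
  assumes C: "C \<in> pverts Q"
  shows "{A \<in> K. F A \<in> hyperspace G C} = hyperspace G (class_map C)"
proof (rule card_subset_eq)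
  have q: "class_map C \<in> pverts Q" using class_map C by blast
  show "finite (hyperspace G (class_map C))" using finite_hyperspace_class q .
  show "card {A \<in> K. F A \<in> hyperspace G C} = card (hyperspace G (class_map C))"
    using card_preimage_hyperspace[OF C] card_hyperspace_class[OF q]
      class_map_local_bijection(2)[OF C] by simp
qed (rule preimage_hyperspace_subset[OF C])

end

theorem theorem4p11:
  fixes G :: "'a pair_pre_digraph" and k :: nat and F :: "'a set \<Rightarrow> 'a set"
  assumes "pair_bidirected_digraph G"
    and "Digraph_Component.connected (with_proj G)"
    and "locally_finite G"
    and "regular k G"
    and "bij_betw F (hyperspace G (pverts G)) (hyperspace G (pverts G))"
    and "\<forall>A\<in>hyperspace G (pverts G). \<forall>B\<in>hyperspace G (pverts G).
           hausdorff_dist (path_dist G) (F A) (F B) \<le> hausdorff_dist (path_dist G) A B"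
  shows "\<exists>q. bij_betw q (pverts (twin_quotient G)) (pverts (twin_quotient G)) \<and>
             (\<forall>C\<in>pverts (twin_quotient G). \<forall>D\<in>pverts (twin_quotient G).
                path_dist (twin_quotient G) (q C) (q D) = path_dist (twin_quotient G) C D) \<and>
             (\<forall>C\<in>pverts (twin_quotient G).
                {A \<in> hyperspace G (pverts G). F A \<in> hyperspace G C} = hyperspace G (q C) \<and>
                card (q C) = card C)"
proof -
  interpret pair_bidirected_digraph G by (rule assms(1))
  interpret nonexpansive_bijection G k F
    by unfold_locales (use assms in auto)
  show ?thesis
    using bij_class_map path_dist_class_map preimage_hyperspace_eq
      class_map_local_bijection(2) by blast
qed

end
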